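(* Consider a two-moduli system with $m_\ell=m\Gamma_\ell$ ($\ell=1,2$), $m>0$ real, where $\Gamma_1<\Gamma_2$ are coprime positive integers, yielding $K$ robust layers followed by one full CRT layer. Let $x$ be a (non-negative) real-valued random signal drawn from a continuous distribution, and assume that $x$ is independent of the noise terms $e_1,e_2$, which are independent of each other. Let $\{P_j\}_{j=0}^{K+1}$ be the dynamic-range breakpoints with $P_0=0$, let $\{\sigma_j\}_{j=1}^{K+1}$ be the Euclidean-remainder sequence, and let $\tau_j=\frac{m\sigma_j}{4}$ for $1\le j\le K+1$. Then the reconstruction success probability $\eta_{\mathrm{succ}}$ of the pairwise-difference decoder satisfies $$\eta_{\mathrm{succ}}\ \ge\ \sum_{j=1}^{K+1}\mathbb P\big(|e_1-e_2|<2\tau_j\big)\;\mathbb P\big(x\in[P_{j-1},P_j)\big),$$ where the first factor is taken with respect to $(e_1,e_2)$ and the second with respect to $x$.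
   Context: **Setting.** A real $x\ge0$ has folding integers $n_\ell=\lfloor x/m_\ell\rfloor$ and remainders $r_\ell=x-n_\ell m_\ell$; one observes $\tilde r_\ell=r_\ell+e_\ell$, $\ell=1,2$. **Layers.** Put $\sigma_{-1}=\Gamma_2$, $\sigma_0=\Gamma_1$, $\sigma_j=\sigma_{j-2}\bmod\sigma_{j-1}$ for $j\ge1$; $K$ is the index with $\sigma_{K+1}=1$. For $1\le j\le K+1$, $P_j=mN_j$, where $N_{-1}=\Gamma_1$, $N_0=\Gamma_2$, and $N_j=N_{j-2}+\lfloor\sigma_{j-1}/\sigma_j\rfloor(N_{j-1}-\sigma_j)$ for $j\ge1$. In the claim, $P_0$ is set to $0$ by convention (it is not $mN_0$). **Decoder and success.** Note $r_1-r_2=n_2m_2-n_1m_1$. The layer-$j$ pairwise-difference decoder outputs the pair of folding integers $(n_1,n_2)$, among those arising from some point of $[0,P_j)$, whose value $n_2m_2-n_1m_1$ is nearest to $\tilde r_1-\tilde r_2$. When $x\in[P_{j-1},P_j)$ the layer-$j$ decoder is used. Reconstruction is successful if the decoded folding integers equal the true ones; $\eta_{\mathrm{succ}}$ is the probability of this event. A known result of the literature (layered robust CRT) states that for $x\in[0,P_j)$ the layer-$j$ decoder recovers $(n_1,n_2)$ correctly whenever $|e_1-e_2|<m\sigma_j/2$. *)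

theory Defs
  imports "HOL-Probability.Probability"
begin

definition folding_int :: "real \<Rightarrow> int \<Rightarrow> real \<Rightarrow> int" where
  "folding_int m G x = \<lfloor>x / (m * of_int G)\<rfloor>"

definition remainder :: "real \<Rightarrow> int \<Rightarrow> real \<Rightarrow> real" where
  "remainder m G x = x - of_int (folding_int m G x) * (m * of_int G)"

text \<open>The sequences are indexed by integers so that the initial index \<open>-1\<close> can be kept.
  Values at indices below \<open>-1\<close> are irrelevant.\<close>

function sigma :: "int \<Rightarrow> int \<Rightarrow> int \<Rightarrow> int" where
  "sigma G1 G2 j =
     (if j \<le> -1 then G2
      else if j = 0 then G1
      else sigma G1 G2 (j - 2) mod sigma G1 G2 (j - 1))"
  by pat_completeness auto
termination by (relation "Wellfounded.measure (\<lambda>(_, _, j). nat (j + 1))") auto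

function range_num :: "int \<Rightarrow> int \<Rightarrow> int \<Rightarrow> int" where
  "range_num G1 G2 j =
     (if j \<le> -1 then G1
      else if j = 0 then G2
      else range_num G1 G2 (j - 2)
         + (sigma G1 G2 (j - 1) div sigma G1 G2 j) * (range_num G1 G2 (j - 1) - sigma G1 G2 j))"
  by pat_completeness auto
termination by (relation "Wellfounded.measure (\<lambda>(_, _, j). nat (j + 1))") auto

declare sigma.simps [simp del] range_num.simps [simp del]

text \<open>The number \<open>K\<close> of robust layers is the index with \<open>\<sigma>\<^sub>K\<^sub>+\<^sub>1 = 1\<close>.
  The least such index is taken because \<open>a mod 0 = a\<close> makes the value \<open>1\<close> reappear after the
  remainder sequence has reached \<open>0\<close>. It is an integer since \<open>K = -1\<close> (no layer at all)
  when \<open>\<Gamma>\<^sub>1 = 1\<close>.\<close>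

definition robust_layers :: "int \<Rightarrow> int \<Rightarrow> int" where
  "robust_layers G1 G2 = int (LEAST k. sigma G1 G2 (int k) = 1) - 1"

definition breakpoint :: "real \<Rightarrow> int \<Rightarrow> int \<Rightarrow> int \<Rightarrow> real" where
  "breakpoint m G1 G2 j = (if j = 0 then 0 else m * of_int (range_num G1 G2 j))"

definition tau :: "real \<Rightarrow> int \<Rightarrow> int \<Rightarrow> int \<Rightarrow> real" where
  "tau m G1 G2 j = m * of_int (sigma G1 G2 j) / 4"

definition folding_pair :: "real \<Rightarrow> int \<Rightarrow> int \<Rightarrow> real \<Rightarrow> int \<times> int" where
  "folding_pair m G1 G2 x = (folding_int m G1 x, folding_int m G2 x)"

definition candidates :: "real \<Rightarrow> int \<Rightarrow> int \<Rightarrow> int \<Rightarrow> (int \<times> int) set" where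
  "candidates m G1 G2 j = folding_pair m G1 G2 ` {0..<breakpoint m G1 G2 j}"

definition pair_diff :: "real \<Rightarrow> int \<Rightarrow> int \<Rightarrow> int \<times> int \<Rightarrow> real" where
  "pair_diff m G1 G2 = (\<lambda>(n1, n2). of_int n2 * (m * of_int G2) - of_int n1 * (m * of_int G1))"

text \<open>\<open>D j d\<close> is the output of the layer-\<open>j\<close> decoder on the observed difference \<open>d\<close> of the
  two noisy remainders. How ties between equally near candidates are broken is left open.\<close>

definition pairwise_diff_decoder ::
  "real \<Rightarrow> int \<Rightarrow> int \<Rightarrow> (int \<Rightarrow> real \<Rightarrow> int \<times> int) \<Rightarrow> bool" where
  "pairwise_diff_decoder m G1 G2 D \<longleftrightarrow>
     (\<forall>j\<in>{1..robust_layers G1 G2 + 1}. \<forall>d.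
        is_arg_min (\<lambda>p. \<bar>pair_diff m G1 G2 p - d\<bar>) (\<lambda>p. p \<in> candidates m G1 G2 j) (D j d))"

text \<open>A signal outside all layers has no decoder assigned to it and counts as a failure.\<close>

definition reconstructs ::
  "real \<Rightarrow> int \<Rightarrow> int \<Rightarrow> (int \<Rightarrow> real \<Rightarrow> int \<times> int) \<Rightarrow> real \<Rightarrow> real \<Rightarrow> real \<Rightarrow> bool" where
  "reconstructs m G1 G2 D x e1 e2 \<longleftrightarrow>
     (\<exists>j\<in>{1..robust_layers G1 G2 + 1}.
        x \<in> {breakpoint m G1 G2 (j - 1)..<breakpoint m G1 G2 j} \<and>
        D j ((remainder m G1 x + e1) - (remainder m G2 x + e2)) = folding_pair m G1 G2 x)"

definition success_prob ::
  "'a measure \<Rightarrow> real \<Rightarrow> int \<Rightarrow> int \<Rightarrow> (int \<Rightarrow> real \<Rightarrow> int \<times> int) \<Rightarrow>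
     ('a \<Rightarrow> real) \<Rightarrow> ('a \<Rightarrow> real) \<Rightarrow> ('a \<Rightarrow> real) \<Rightarrow> real" where
  "success_prob M m G1 G2 D X E1 E2 =
     measure M {\<omega> \<in> space M. reconstructs m G1 G2 D (X \<omega>) (E1 \<omega>) (E2 \<omega>)}"

text \<open>Unlike \<^const>\<open>prob_space.indep_var\<close>, this allows the two variables to have different
  value types, as needed for a signal and a pair of noise terms.\<close>

definition (in prob_space) indep_rv ::
  "'b measure \<Rightarrow> ('a \<Rightarrow> 'b) \<Rightarrow> 'c measure \<Rightarrow> ('a \<Rightarrow> 'c) \<Rightarrow> bool" where
  "indep_rv S X T Y \<longleftrightarrow>
     random_variable S X \<and> random_variable T Y \<and>
     indep_set {X -` A \<inter> space M | A. A \<in> sets S} {Y -` B \<inter> space M | B. B \<in> sets T}"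

end

theory Submission
  imports Defs
begin

text \<open>For \<open>x = m u\<close> the folding integers only depend on the integer part of \<open>u\<close>, so separating
  the layer-\<open>j\<close> candidates is a statement about integers \<open>u, v\<close> in \<open>[0, N\<^sub>j)\<close>: if their folding
  integers differ by \<open>(a, b)\<close> and \<open>\<bar>b \<Gamma>\<^sub>2 - a \<Gamma>\<^sub>1\<bar> < \<sigma>\<^sub>j\<close>, then \<open>a = b = 0\<close>. Expanding \<open>(a, b)\<close> in the
  unimodular basis of the two Euclidean convergents that realise \<open>\<sigma>\<^sub>j\<close> and \<open>\<sigma>\<^sub>j\<^sub>+\<^sub>1\<close> up to opposite
  signs, a small combination must have coefficients of equal sign; hence \<open>(a, b)\<close> dominates the
  second convergent \<open>(A', B')\<close>, and \<open>N\<^sub>j = max (A' \<Gamma>\<^sub>1) (B' \<Gamma>\<^sub>2)\<close> is out of reach. The decoder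
  therefore succeeds on the disjoint events \<open>x \<in> [P\<^sub>j\<^sub>-\<^sub>1, P\<^sub>j)\<close>, \<open>\<bar>e\<^sub>1 - e\<^sub>2\<bar> < m \<sigma>\<^sub>j / 2\<close>, whose
  probabilities factor by independence.\<close>

section \<open>Remainder sequence and range numbers\<close>

lemma sigma_0 [simp]: "sigma G1 G2 0 = G1"
  by (simp add: sigma.simps)

lemma sigma_1 [simp]: "sigma G1 G2 1 = G2 mod G1"
  by (simp add: sigma.simps[of _ _ 1] sigma.simps[of _ _ "-1"])

lemma sigma_rec: "sigma G1 G2 (int k + 2) = sigma G1 G2 (int k) mod sigma G1 G2 (int k + 1)"
  by (subst sigma.simps) (simp add: algebra_simps)

lemma range_num_minus_1 [simp]: "range_num G1 G2 (-1) = G1"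
  by (simp add: range_num.simps)

lemma range_num_0 [simp]: "range_num G1 G2 0 = G2"
  by (simp add: range_num.simps)

lemma range_num_rec:
  "range_num G1 G2 (int k + 1) = range_num G1 G2 (int k - 1)
     + (sigma G1 G2 (int k) div sigma G1 G2 (int k + 1))
       * (range_num G1 G2 (int k) - sigma G1 G2 (int k + 1))"
  by (subst range_num.simps) (simp add: algebra_simps)

context
  fixes G1 G2 :: int
  assumes G1_pos: "0 < G1" and G1_less_G2: "G1 < G2"
begin

lemma sigma_nonneg_le: "0 \<le> sigma G1 G2 (int k) \<and> sigma G1 G2 (int k) \<le> G1"
proof (induction k rule: less_induct)
  case (less k)
  consider "k = 0" | "k = 1" | i where "k = Suc (Suc i)"
    by (metis One_nat_def not0_implies_Suc)
  then show ?case
  proof cases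
    case 1
    then show ?thesis using G1_pos by simp
  next
    case 2
    then show ?thesis using G1_pos pos_mod_bound[of G1 G2] by (simp add: less_imp_le)
  next
    case 3
    then have IH: "0 \<le> sigma G1 G2 (int i)" "sigma G1 G2 (int i) \<le> G1"
        "0 \<le> sigma G1 G2 (int i + 1)"
      using less.IH[of i] less.IH[of "Suc i"] by (simp_all add: add.commute)
    have "sigma G1 G2 (int k) = sigma G1 G2 (int i) mod sigma G1 G2 (int i + 1)"
      using 3 sigma_rec[of G1 G2 i] by (simp add: algebra_simps)
    \<comment> \<open>The bound must survive past the first zero of the sequence, where
      \<open>x mod 0 = x\<close> and \<open>x mod y < y\<close> fails.\<close>
    moreover have "0 \<le> x mod y \<and> x mod y \<le> x" if "0 \<le> x" "0 \<le> y" for x y :: int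
      using that by (cases "y = 0") (simp_all add: zmod_le_nonneg_dividend)
    ultimately show ?thesis
      using IH by fastforce
  qed
qed

text \<open>Each increment is a Euclidean quotient times a range number minus a remainder; the
  latter never exceeds \<open>G1\<close>. The shifted index starts the induction at -1.\<close>

lemma range_num_ge: "G1 \<le> range_num G1 G2 (int k - 1)"
proof (induction k rule: less_induct)
  case (less k)
  consider "k = 0" | "k = 1" | i where "k = Suc (Suc i)"
    by (metis One_nat_def not0_implies_Suc)
  then show ?case
  proof cases
    case 3
    then have "G1 \<le> range_num G1 G2 (int i - 1)" "G1 \<le> range_num G1 G2 (int i)"
      using less.IH[of i] less.IH[of "Suc i"] by (simp_all add: add.commute)
    moreover have "0 \<le> (sigma G1 G2 (int i) div sigma G1 G2 (int i + 1))
        * (range_num G1 G2 (int i) - sigma G1 G2 (int i + 1))"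
      using calculation sigma_nonneg_le[of i] sigma_nonneg_le[of "Suc i"]
      by (intro mult_nonneg_nonneg div_int_pos_iff[THEN iffD2]) (auto simp: add.commute)
    ultimately show ?thesis
      using 3 range_num_rec[of G1 G2 i] by (simp add: algebra_simps)
  qed (use G1_less_G2 in auto)
qed

section \<open>Euclidean convergents and small combinations\<close>

text \<open>The convergents are \<open>B/A\<close> and \<open>B'/A'\<close>. The last two equations say that \<open>N\<^sub>k\<^sub>-\<^sub>1\<close> and \<open>N\<^sub>k\<close> are the
  maxima of the two products, since \<open>\<sigma>\<^sub>k\<close> and \<open>\<sigma>\<^sub>k\<^sub>+\<^sub>1\<close> are their absolute differences.\<close>

lemma convergents:
  "\<exists>A B A' B' \<epsilon>. 0 \<le> A \<and> 0 \<le> B \<and> 0 \<le> A' \<and> 0 \<le> B' \<and> (\<epsilon> = 1 \<or> \<epsilon> = (-1::int)) \<and>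
     A * B' - A' * B = \<epsilon> \<and>
     B * G2 - A * G1 = - \<epsilon> * sigma G1 G2 (int k) \<and>
     B' * G2 - A' * G1 = \<epsilon> * sigma G1 G2 (int k + 1) \<and>
     2 * range_num G1 G2 (int k - 1) = A * G1 + B * G2 + sigma G1 G2 (int k) \<and>
     2 * range_num G1 G2 (int k) = A' * G1 + B' * G2 + sigma G1 G2 (int k + 1)"
proof (induction k)
  case 0
  \<comment> \<open>The witnesses are \<open>(A, B) = (1, 0)\<close>,
    \<open>(A', B') = (G2 div G1, 1)\<close> and \<open>\<epsilon> = 1\<close>.\<close>
  show ?case
    using G1_pos G1_less_G2
    by (intro exI[of _ 1] exI[of _ 0] exI[of _ "G2 div G1"])
      (auto simp: minus_mult_div_eq_mod pos_imp_zdiv_nonneg_iff minus_div_mult_eq_mod)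
next
  case (Suc k)
  then obtain A B A' B' \<epsilon> where *: "0 \<le> A" "0 \<le> B" "0 \<le> A'" "0 \<le> B'" "\<epsilon> = 1 \<or> \<epsilon> = (-1::int)"
     "A * B' - A' * B = \<epsilon>"
     "B * G2 - A * G1 = - \<epsilon> * sigma G1 G2 (int k)"
     "B' * G2 - A' * G1 = \<epsilon> * sigma G1 G2 (int k + 1)"
     "2 * range_num G1 G2 (int k - 1) = A * G1 + B * G2 + sigma G1 G2 (int k)"
     "2 * range_num G1 G2 (int k) = A' * G1 + B' * G2 + sigma G1 G2 (int k + 1)"
    by blast
  \<comment> \<open>With the Euclidean quotient \<open>c\<close>, the new pairs are
    \<open>(A', B')\<close> and \<open>(A + c * A', B + c * B')\<close>, and the sign flips.\<close>
  define c where "c = sigma G1 G2 (int k) div sigma G1 G2 (int k + 1)"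
  have c: "0 \<le> c"
    unfolding c_def using sigma_nonneg_le[of k] sigma_nonneg_le[of "Suc k"]
    by (intro div_int_pos_iff[THEN iffD2]) (auto simp: add.commute)
  have s: "sigma G1 G2 (int k + 2) = sigma G1 G2 (int k) - c * sigma G1 G2 (int k + 1)"
    by (simp add: sigma_rec c_def minus_div_mult_eq_mod)
  have n: "range_num G1 G2 (int k + 1) = range_num G1 G2 (int k - 1)
      + c * (range_num G1 G2 (int k) - sigma G1 G2 (int k + 1))"
    by (simp add: range_num_rec c_def)
  have ix: "int (Suc k) = int k + 1" "int k + 1 + 1 = int k + 2" "int k + 1 - 1 = int k"
    by simp_all
  have d: "A' * (B + c * B') - (A + c * A') * B' = - \<epsilon>"
    using *(6) by (simp add: algebra_simps)
  have e: "(B + c * B') * G2 - (A + c * A') * G1 = - \<epsilon> * sigma G1 G2 (int k + 2)"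
  proof -
    have "(B + c * B') * G2 - (A + c * A') * G1 = (B * G2 - A * G1) + c * (B' * G2 - A' * G1)"
      by (simp add: algebra_simps)
    then show ?thesis unfolding *(7,8) s by (simp add: algebra_simps)
  qed
  have f: "2 * range_num G1 G2 (int k + 1)
      = (A + c * A') * G1 + (B + c * B') * G2 + sigma G1 G2 (int k + 2)"
  proof -
    have "2 * range_num G1 G2 (int k + 1) = 2 * range_num G1 G2 (int k - 1)
      + c * (2 * range_num G1 G2 (int k) - 2 * sigma G1 G2 (int k + 1))"
      unfolding n by (simp add: algebra_simps)
    then show ?thesis unfolding *(9,10) s by (simp add: algebra_simps)
  qed
  show ?case
    unfolding ix
    by (rule exI[of _ A'], rule exI[of _ B'], rule exI[of _ "A + c * A'"],
        rule exI[of _ "B + c * B'"], rule exI[of _ "- \<epsilon>"], intro conjI d e f)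
      (use *(1-5,8,10) c in auto)
qed

lemma small_combination_range:
  fixes a b v :: int
  assumes ab: "0 \<le> a" "0 \<le> b" "(a, b) \<noteq> (0, 0)"
    and small: "\<bar>b * G2 - a * G1\<bar> < sigma G1 G2 (int k)"
    and v: "a * G1 \<le> v" "b * G2 \<le> v"
  shows "range_num G1 G2 (int k) \<le> v"
proof -
  obtain A B A' B' \<epsilon> where *: "0 \<le> A" "0 \<le> B" "0 \<le> A'" "0 \<le> B'" "\<epsilon> = 1 \<or> \<epsilon> = (-1::int)"
     "A * B' - A' * B = \<epsilon>"
     "B * G2 - A * G1 = - \<epsilon> * sigma G1 G2 (int k)"
     "B' * G2 - A' * G1 = \<epsilon> * sigma G1 G2 (int k + 1)"
     "2 * range_num G1 G2 (int k) = A' * G1 + B' * G2 + sigma G1 G2 (int k + 1)"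
    using convergents[of k] by blast
  \<comment> \<open>Cramer's rule for \<open>(a, b)\<close> in the basis \<open>(A, B)\<close>,
    \<open>(A', B')\<close>. The determinant is \<open>\<epsilon>\<close>, so dividing by it is
    multiplying by it.\<close>
  define s where "s = \<epsilon> * (a * B' - b * A')"
  define t where "t = \<epsilon> * (A * b - B * a)"
  have \<epsilon>: "\<epsilon> * (\<epsilon> * z) = z" for z using *(5) by auto
  have "s * A + t * A' = \<epsilon> * ((A * B' - A' * B) * a)" "s * B + t * B' = \<epsilon> * ((A * B' - A' * B) * b)"
    by (simp_all add: s_def t_def algebra_simps)
  then have a: "a = s * A + t * A'" and b: "b = s * B + t * B'"
    unfolding *(6) by (simp_all add: \<epsilon>)
  have "b * G2 - a * G1 = s * (B * G2 - A * G1) + t * (B' * G2 - A' * G1)"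
    by (simp add: a b algebra_simps)
  then have "b * G2 - a * G1 = \<epsilon> * (t * sigma G1 G2 (int k + 1) - s * sigma G1 G2 (int k))"
    unfolding *(7,8) by (simp add: algebra_simps)
  then have st: "\<bar>t * sigma G1 G2 (int k + 1) - s * sigma G1 G2 (int k)\<bar> < sigma G1 G2 (int k)"
    using small *(5) by auto
  have \<sigma>: "0 \<le> sigma G1 G2 (int k)" "0 \<le> sigma G1 G2 (int k + 1)"
    using sigma_nonneg_le[of k] sigma_nonneg_le[of "Suc k"] by (simp_all add: add.commute)
  have "0 \<le> s \<and> 1 \<le> t"
  \<comment> \<open>Two nonpositive coefficients contradict \<open>ab\<close>; strictly opposite
    signs, or \<open>s > 0\<close> with \<open>t = 0\<close>, make the combination at least
    \<open>\<sigma>_k\<close> in absolute value.\<close>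
  proof (rule ccontr)
    assume "\<not> (0 \<le> s \<and> 1 \<le> t)"
    then consider "s \<le> 0" "t \<le> 0" | "1 \<le> s" "t \<le> 0" | "s \<le> -1" "1 \<le> t" by linarith
    then show False
    proof cases
      case 1
      then have "a \<le> 0" "b \<le> 0"
        unfolding a b using *(1-4) by (intro add_nonpos_nonpos mult_nonpos_nonneg; simp)+
      then show False using ab by simp
    next
      case 2
      then have "sigma G1 G2 (int k) \<le> s * sigma G1 G2 (int k)" "t * sigma G1 G2 (int k + 1) \<le> 0"
        using \<sigma> by (simp_all add: mult_le_cancel_right1 mult_nonpos_nonneg)
      then show False using st by linarith
    next
      case 3
      then have "s * sigma G1 G2 (int k) \<le> (-1) * sigma G1 G2 (int k)"
        using \<sigma> by (intro mult_right_mono) auto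
      moreover have "0 \<le> t * sigma G1 G2 (int k + 1)"
        using 3 \<sigma> by simp
      ultimately show False using st by linarith
    qed
  qed
  then have "A' \<le> t * A'" "B' \<le> t * B'" "0 \<le> s * A" "0 \<le> s * B"
    using *(1-4) by (simp_all add: mult_le_cancel_right1)
  then have "A' \<le> a" "B' \<le> b"
    unfolding a b by linarith+
  then have "A' * G1 \<le> v" "B' * G2 \<le> v"
    using v G1_pos G1_less_G2 mult_right_mono[of A' a G1] mult_right_mono[of B' b G2] by linarith+
  \<comment> \<open>The sign decides which product is \<open>N_k\<close>: \<open>B' * G2\<close> for
    \<open>\<epsilon> = 1\<close>, \<open>A' * G1\<close> for
    \<open>\<epsilon> = -1\<close>.\<close>
  then show ?thesis
    using *(5,8,9) by auto
qed

section \<open>Separation of the candidates of a layer\<close>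

lemma candidates_separated:
  assumes m: "0 < m"
    and p: "p \<in> candidates m G1 G2 (int k)" and q: "q \<in> candidates m G1 G2 (int k)"
    and close: "\<bar>pair_diff m G1 G2 p - pair_diff m G1 G2 q\<bar> < m * of_int (sigma G1 G2 (int k))"
  shows "p = q"
proof -
  have G2_pos: "0 < G2" using G1_pos G1_less_G2 by simp
  have fold_div: "folding_int m G x = \<lfloor>x / m\<rfloor> div G" if "0 < G" for G x
    using that floor_divide_real_eq_div[of G "x / m"] by (simp add: folding_int_def)
  have cand: "\<exists>u. 0 \<le> u \<and> u < range_num G1 G2 (int k) \<and> r = (u div G1, u div G2)"
    if r: "r \<in> candidates m G1 G2 (int k)" for r
  proof -
    obtain x where x: "0 \<le> x" "x < breakpoint m G1 G2 (int k)" "r = folding_pair m G1 G2 x"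
      using r unfolding candidates_def by auto
    \<comment> \<open>For \<open>k = 0\<close> the breakpoint is 0 by convention, so there is no
      such \<open>x\<close>.\<close>
    then have "x < m * of_int (range_num G1 G2 (int k))"
      by (auto simp: breakpoint_def split: if_splits)
    then have "\<lfloor>x / m\<rfloor> < range_num G1 G2 (int k)"
      using m by (simp add: floor_less_iff divide_less_eq mult.commute)
    then show ?thesis
      using x m G1_pos G2_pos by (intro exI[of _ "\<lfloor>x / m\<rfloor>"]) (auto simp: folding_pair_def fold_div)
  qed
  \<comment> \<open>Ordering the underlying integers makes both coordinates of the difference
    nonnegative, as \<open>small_combination_range\<close> requires.\<close>
  have main: "r = s"
    if "0 \<le> u" "u \<le> v" "v < range_num G1 G2 (int k)"
      and r: "r = (u div G1, u div G2)" and s: "s = (v div G1, v div G2)"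
      and small: "\<bar>pair_diff m G1 G2 s - pair_diff m G1 G2 r\<bar> < m * of_int (sigma G1 G2 (int k))"
    for u v r s
  proof (rule ccontr)
    assume "r \<noteq> s"
    define a where "a = v div G1 - u div G1"
    define b where "b = v div G2 - u div G2"
    have "0 \<le> a" "0 \<le> b"
      using that G1_pos G2_pos by (simp_all add: a_def b_def zdiv_mono1)
    moreover have "(a, b) \<noteq> (0, 0)"
      using \<open>r \<noteq> s\<close> by (auto simp: a_def b_def r s)
    moreover have "\<bar>b * G2 - a * G1\<bar> < sigma G1 G2 (int k)"
    proof -
      have "pair_diff m G1 G2 s - pair_diff m G1 G2 r = m * of_int (b * G2 - a * G1)"
        by (simp add: pair_diff_def r s a_def b_def algebra_simps)
      then have "m * of_int \<bar>b * G2 - a * G1\<bar> < m * of_int (sigma G1 G2 (int k))"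
        using small m by (simp add: abs_mult)
      then show ?thesis
        using m by (simp only: mult_less_cancel_left_pos of_int_less_iff)
    qed
    moreover have "a * G1 \<le> v" "b * G2 \<le> v"
    proof -
      have "(v div G - u div G) * G \<le> v" if "0 < G" for G
      proof -
        have "(v div G - u div G) * G \<le> v div G * G"
          using that \<open>0 \<le> u\<close> by (intro mult_right_mono) (auto simp: pos_imp_zdiv_nonneg_iff)
        also have "\<dots> \<le> v"
          using that pos_mod_sign[of G v] div_mult_mod_eq[of v G] by linarith
        finally show ?thesis .
      qed
      then show "a * G1 \<le> v" "b * G2 \<le> v"
        using G1_pos G2_pos by (simp_all add: a_def b_def)
    qed
    ultimately have "range_num G1 G2 (int k) \<le> v"
      by (rule small_combination_range)
    then show False using that by simp
  qed
  obtain u v where "0 \<le> u" "u < range_num G1 G2 (int k)" "p = (u div G1, u div G2)"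
    "0 \<le> v" "v < range_num G1 G2 (int k)" "q = (v div G1, v div G2)"
    using cand[OF p] cand[OF q] by blast
  then show ?thesis
    using main[of u v p q] main[of v u q p] close
    by (cases "u \<le> v") (auto simp: abs_minus_commute)
qed

section \<open>Coprimality, positive remainders and ordered layers\<close>

context
  assumes cop: "coprime G1 G2"
begin

text \<open>Euclid's step preserves coprimality, even past zero because \<open>x mod 0 = x\<close>.
  Hence a zero remainder can only follow a remainder 1.\<close>

lemma sigma_coprime: "coprime (sigma G1 G2 (int k)) (sigma G1 G2 (int k + 1))"
proof (induction k)
  case 0
  then show ?case using cop G1_pos by (simp add: coprime_mod_right_iff)
next
  case (Suc k)
  have "coprime (sigma G1 G2 (int k + 1)) (sigma G1 G2 (int k + 2))"
    using Suc by (cases "sigma G1 G2 (int k + 1) = 0")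
      (simp_all add: sigma_rec coprime_mod_right_iff coprime_commute)
  then show ?case by (simp add: add.commute)
qed

text \<open>A first zero at or before index \<open>K + 1\<close> would by coprimality follow a
  remainder 1 at an index below \<open>K + 1\<close>, against the choice of the least index.\<close>

lemma sigma_pos:
  assumes "int k \<le> robust_layers G1 G2 + 1"
  shows "0 < sigma G1 G2 (int k)"
  using assms
proof (induction k)
  case 0
  then show ?case using G1_pos by simp
next
  case (Suc k)
  then have "k < (LEAST k. sigma G1 G2 (int k) = 1)"
    by (simp add: robust_layers_def)
  then have "sigma G1 G2 (int k) \<noteq> 1"
    using not_less_Least by blast
  moreover have "0 < sigma G1 G2 (int k)"
    using Suc by simp
  ultimately have "sigma G1 G2 (int k + 1) \<noteq> 0"
    using sigma_coprime[of k] by auto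
  then show ?case
    using sigma_nonneg_le[of "Suc k"] by (simp add: add.commute)
qed

lemma sigma_Suc_le:
  assumes "int k + 1 \<le> robust_layers G1 G2 + 1"
  shows "sigma G1 G2 (int k + 1) \<le> sigma G1 G2 (int k)"
proof (cases k)
  case 0
  then show ?thesis using G1_pos by (simp add: less_imp_le)
next
  case (Suc i)
  then show ?thesis
    using assms sigma_pos[of k] sigma_rec[of G1 G2 i] by (simp add: algebra_simps less_imp_le)
qed

text \<open>For \<open>k > 0\<close> the increment is
  \<open>(c - 1) * N_k + N_{k-1} - c * \<sigma>_{k+1}\<close>, where \<open>c \<ge> 1\<close> and
  \<open>c * \<sigma>_{k+1} \<le> \<sigma>_k \<le> G1 \<le> N_{k-1}\<close>.\<close>

lemma breakpoint_mono_Suc: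
  assumes m: "0 < m" and k: "int k + 1 \<le> robust_layers G1 G2 + 1"
  shows "breakpoint m G1 G2 (int k) \<le> breakpoint m G1 G2 (int k + 1)"
proof (cases k)
  case 0
  \<comment> \<open>The left breakpoint is 0 here, not \<open>m * G2\<close>, so the claim is that
    \<open>N_1\<close> is nonnegative.\<close>
  then show ?thesis
    using m G1_pos range_num_ge[of 2] by (simp add: breakpoint_def)
next
  case (Suc i)
  define c where "c = sigma G1 G2 (int k) div sigma G1 G2 (int k + 1)"
  have \<sigma>: "0 < sigma G1 G2 (int k + 1)"
    using sigma_pos[of "Suc k"] k by (simp add: add.commute)
  have "1 \<le> c"
    unfolding c_def using \<sigma> sigma_Suc_le[OF k] by (simp add: pos_imp_zdiv_pos_iff int_one_le_iff_zero_less)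
  have "c * sigma G1 G2 (int k + 1) \<le> sigma G1 G2 (int k)"
    unfolding c_def using \<sigma> pos_mod_sign[OF \<sigma>, of "sigma G1 G2 (int k)"]
      div_mult_mod_eq[of "sigma G1 G2 (int k)" "sigma G1 G2 (int k + 1)"] by linarith
  also have "\<dots> \<le> range_num G1 G2 (int k - 1)"
    using sigma_nonneg_le[of k] range_num_ge[of k] by simp
  finally have "c * sigma G1 G2 (int k + 1) \<le> range_num G1 G2 (int k - 1)" .
  moreover have "range_num G1 G2 (int k) \<le> c * range_num G1 G2 (int k)"
    using \<open>1 \<le> c\<close> range_num_ge[of "Suc k"] G1_pos by (simp add: mult_le_cancel_right1)
  ultimately have "range_num G1 G2 (int k) \<le> range_num G1 G2 (int k + 1)"
    unfolding range_num_rec c_def[symmetric] by (simp add: algebra_simps)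
  then show ?thesis
    using m Suc by (simp add: breakpoint_def)
qed

lemma breakpoint_mono:
  assumes m: "0 < m" and "0 \<le> i" "i \<le> j" "j \<le> robust_layers G1 G2 + 1"
  shows "breakpoint m G1 G2 i \<le> breakpoint m G1 G2 j"
  using \<open>i \<le> j\<close> \<open>j \<le> _\<close>
proof (induction j rule: int_ge_induct)
  case (step j)
  then show ?case
    using breakpoint_mono_Suc[OF m, of "nat j"] \<open>0 \<le> i\<close> by simp
qed simp

lemma breakpoint_nonneg:
  assumes "0 < m" "0 \<le> i" "i \<le> robust_layers G1 G2 + 1"
  shows "0 \<le> breakpoint m G1 G2 i"
  using breakpoint_mono[of m 0 i] assms by (simp add: breakpoint_def)

lemma layers_disjoint:
  assumes m: "0 < m"
    and "i \<in> {1..robust_layers G1 G2 + 1}" "j \<in> {1..robust_layers G1 G2 + 1}"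
    and "x \<in> {breakpoint m G1 G2 (i - 1)..<breakpoint m G1 G2 i}"
      "x \<in> {breakpoint m G1 G2 (j - 1)..<breakpoint m G1 G2 j}"
  shows "i = j"
  using assms breakpoint_mono[OF m, of i "j - 1"] breakpoint_mono[OF m, of j "i - 1"]
  by (cases i j rule: linorder_cases) auto

lemma folding_pair_candidate:
  assumes "0 < m" "j \<in> {1..robust_layers G1 G2 + 1}"
    and "x \<in> {breakpoint m G1 G2 (j - 1)..<breakpoint m G1 G2 j}"
  shows "folding_pair m G1 G2 x \<in> candidates m G1 G2 j"
  using assms breakpoint_nonneg[of m "j - 1"] by (auto simp: candidates_def)

lemma remainder_diff:
  "remainder m G1 x - remainder m G2 x = pair_diff m G1 G2 (folding_pair m G1 G2 x)"
  by (simp add: remainder_def pair_diff_def folding_pair_def)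

text \<open>Distinct candidates have values at least \<open>m * \<sigma>_j > 0\<close> apart. This
  turns equality of integer pairs into an equation between reals.\<close>

lemma candidates_eq_iff:
  assumes "0 < m" "j \<in> {1..robust_layers G1 G2 + 1}"
    and "p \<in> candidates m G1 G2 j" "q \<in> candidates m G1 G2 j"
  shows "p = q \<longleftrightarrow> pair_diff m G1 G2 p = pair_diff m G1 G2 q"
  using assms candidates_separated[of m p "nat j" q] sigma_pos[of "nat j"] by auto

section \<open>Nearest-candidate decoding and measurability\<close>

context
  fixes m :: real and D :: "int \<Rightarrow> real \<Rightarrow> int \<times> int"
  assumes m: "0 < m" and D: "pairwise_diff_decoder m G1 G2 D"
begin

lemma decoder_candidate:
  assumes "j \<in> {1..robust_layers G1 G2 + 1}"
  shows "D j d \<in> candidates m G1 G2 j"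
  using D assms unfolding pairwise_diff_decoder_def is_arg_min_def by blast

lemma decoder_nearest:
  assumes "j \<in> {1..robust_layers G1 G2 + 1}" "p \<in> candidates m G1 G2 j"
  shows "\<bar>pair_diff m G1 G2 (D j d) - d\<bar> \<le> \<bar>pair_diff m G1 G2 p - d\<bar>"
  using D assms unfolding pairwise_diff_decoder_def is_arg_min_def by (meson not_less)

text \<open>Nearest-point maps are monotone however ties are broken; this makes every decoder measurable.\<close>

lemma decoder_mono:
  assumes j: "j \<in> {1..robust_layers G1 G2 + 1}"
  shows "mono (\<lambda>d. pair_diff m G1 G2 (D j d))"
proof
  fix d d' :: real
  assume "d \<le> d'"
  \<comment> \<open>If \<open>d < d'\<close> and the value dropped, \<open>d\<close> would lie at or
    above the midpoint of the two values and \<open>d'\<close> at or below it. For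
    \<open>d = d'\<close> the inequalities alone would allow a tie.\<close>
  then show "pair_diff m G1 G2 (D j d) \<le> pair_diff m G1 G2 (D j d')"
    using decoder_nearest[OF j decoder_candidate[OF j, of d'], of d]
      decoder_nearest[OF j decoder_candidate[OF j, of d], of d']
    by (cases "d = d'") (simp, linarith)
qed

text \<open>The true value is \<open>\<bar>e1 - e2\<bar>\<close> away from the observation and the
  decoded one is no farther. By the triangle inequality they are less than
  \<open>4 * \<tau>_j = m * \<sigma>_j\<close> apart, so separation applies.\<close>

lemma decoder_correct:
  assumes j: "j \<in> {1..robust_layers G1 G2 + 1}"
    and x: "x \<in> {breakpoint m G1 G2 (j - 1)..<breakpoint m G1 G2 j}"
    and e: "\<bar>e1 - e2\<bar> < 2 * tau m G1 G2 j"
  shows "D j ((remainder m G1 x + e1) - (remainder m G2 x + e2)) = folding_pair m G1 G2 x"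
proof -
  let ?p = "folding_pair m G1 G2 x"
  let ?d = "(remainder m G1 x + e1) - (remainder m G2 x + e2)"
  have p: "?p \<in> candidates m G1 G2 j"
    using folding_pair_candidate[OF m j x] .
  have "\<bar>pair_diff m G1 G2 (D j ?d) - ?d\<bar> \<le> \<bar>pair_diff m G1 G2 ?p - ?d\<bar>"
    using decoder_nearest[OF j p] .
  moreover have "\<bar>pair_diff m G1 G2 ?p - ?d\<bar> = \<bar>e1 - e2\<bar>"
    using remainder_diff[of m x] by linarith
  moreover have "2 * (2 * tau m G1 G2 j) = m * of_int (sigma G1 G2 j)"
    by (simp add: tau_def)
  ultimately have "\<bar>pair_diff m G1 G2 (D j ?d) - pair_diff m G1 G2 ?p\<bar> < m * of_int (sigma G1 G2 j)"
    using e by linarith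
  then show ?thesis
    using candidates_separated[OF m, of "D j ?d" "nat j" ?p] p decoder_candidate[OF j] j by simp
qed

text \<open>In this form the decoder enters only through its monotone real value, so measurability
  of \<open>D\<close> itself never has to be assumed.\<close>

lemma reconstructs_eq:
  "reconstructs m G1 G2 D x e1 e2 \<longleftrightarrow>
     (\<exists>j\<in>{1..robust_layers G1 G2 + 1}.
        x \<in> {breakpoint m G1 G2 (j - 1)..<breakpoint m G1 G2 j} \<and>
        pair_diff m G1 G2 (D j ((remainder m G1 x + e1) - (remainder m G2 x + e2)))
          = remainder m G1 x - remainder m G2 x)"
  unfolding reconstructs_def remainder_diff
  using candidates_eq_iff[OF m _ decoder_candidate folding_pair_candidate[OF m]]
  by (intro bex_cong refl conj_cong) auto

text \<open>Needed for the final estimate: \<open>measure\<close> is 0 on a non-measurable set, so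
  inclusion of events alone would bound nothing.\<close>

lemma reconstructs_measurable:
  assumes [measurable]: "X \<in> borel_measurable M" "E1 \<in> borel_measurable M" "E2 \<in> borel_measurable M"
  shows "{\<omega> \<in> space M. reconstructs m G1 G2 D (X \<omega>) (E1 \<omega>) (E2 \<omega>)} \<in> sets M"
proof -
  have R [measurable]: "remainder m G \<in> borel_measurable borel" for G
    unfolding remainder_def[abs_def] folding_int_def by measurable
  have "{\<omega> \<in> space M. reconstructs m G1 G2 D (X \<omega>) (E1 \<omega>) (E2 \<omega>)} =
    (\<Union>j\<in>{1..robust_layers G1 G2 + 1}. {\<omega> \<in> space M.
        X \<omega> \<in> {breakpoint m G1 G2 (j - 1)..<breakpoint m G1 G2 j} \<and>
        pair_diff m G1 G2 (D j ((remainder m G1 (X \<omega>) + E1 \<omega>) - (remainder m G2 (X \<omega>) + E2 \<omega>)))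
          = remainder m G1 (X \<omega>) - remainder m G2 (X \<omega>)})"
    unfolding reconstructs_eq by blast
  also have "\<dots> \<in> sets M"
  proof (intro sets.finite_UN)
    fix j assume j: "j \<in> {1..robust_layers G1 G2 + 1}"
    have [measurable]: "(\<lambda>d. pair_diff m G1 G2 (D j d)) \<in> borel_measurable borel"
      using decoder_mono[OF j] by (rule borel_measurable_mono)
    show "{\<omega> \<in> space M.
        X \<omega> \<in> {breakpoint m G1 G2 (j - 1)..<breakpoint m G1 G2 j} \<and>
        pair_diff m G1 G2 (D j ((remainder m G1 (X \<omega>) + E1 \<omega>) - (remainder m G2 (X \<omega>) + E2 \<omega>)))
          = remainder m G1 (X \<omega>) - remainder m G2 (X \<omega>)} \<in> sets M"
      by measurable
  qed simp
  finally show ?thesis .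
qed

end
end
end

section \<open>Factorisation by independence and the final bound\<close>

lemma (in prob_space) indep_rv_prob:
  assumes "indep_rv S X T Y" "A \<in> sets S" "B \<in> sets T"
  shows "prob {\<omega> \<in> space M. X \<omega> \<in> A \<and> Y \<omega> \<in> B}
    = prob {\<omega> \<in> space M. X \<omega> \<in> A} * prob {\<omega> \<in> space M. Y \<omega> \<in> B}"
proof -
  have "prob ((X -` A \<inter> space M) \<inter> (Y -` B \<inter> space M))
      = prob (X -` A \<inter> space M) * prob (Y -` B \<inter> space M)"
    using assms unfolding indep_rv_def by (intro indep_setD) blast+
  moreover have "{\<omega> \<in> space M. X \<omega> \<in> A \<and> Y \<omega> \<in> B} = (X -` A \<inter> space M) \<inter> (Y -` B \<inter> space M)"
    "{\<omega> \<in> space M. X \<omega> \<in> A} = X -` A \<inter> space M" "{\<omega> \<in> space M. Y \<omega> \<in> B} = Y -` B \<inter> space M"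
    by auto
  ultimately show ?thesis by simp
qed

theorem proposition4:
  fixes m :: real and G1 G2 :: int
    and M :: "'a measure" and X E1 E2 :: "'a \<Rightarrow> real"
    and D :: "int \<Rightarrow> real \<Rightarrow> int \<times> int"
  assumes "m > 0"
    and "0 < G1" and "G1 < G2" and "coprime G1 G2"
    and "prob_space M"
    and "X \<in> borel_measurable M"
    and "E1 \<in> borel_measurable M" and "E2 \<in> borel_measurable M"
    and "AE \<omega> in M. 0 \<le> X \<omega>"
    and "continuous_on UNIV (cdf (distr M borel X))"
    and "prob_space.indep_rv M borel X (borel \<Otimes>\<^sub>M borel) (\<lambda>\<omega>. (E1 \<omega>, E2 \<omega>))"
    and "prob_space.indep_var M borel E1 borel E2"
    and "pairwise_diff_decoder m G1 G2 D"
  shows "success_prob M m G1 G2 D X E1 E2 \<ge>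
    (\<Sum>j = 1..robust_layers G1 G2 + 1.
        measure M {\<omega> \<in> space M. \<bar>E1 \<omega> - E2 \<omega>\<bar> < 2 * tau m G1 G2 j} *
        measure M {\<omega> \<in> space M. X \<omega> \<in> {breakpoint m G1 G2 (j - 1)..<breakpoint m G1 G2 j}})"
proof -
  interpret prob_space M by fact
  note [measurable] = assms(6-8)
  let ?J = "{1..robust_layers G1 G2 + 1}"
  let ?I = "\<lambda>j. {breakpoint m G1 G2 (j - 1)..<breakpoint m G1 G2 j}"
  let ?N = "\<lambda>j. {e. \<bar>fst e - snd e\<bar> < 2 * tau m G1 G2 j}"
  define S where "S j = {\<omega> \<in> space M. X \<omega> \<in> ?I j \<and> (E1 \<omega>, E2 \<omega>) \<in> ?N j}" for j
  \<comment> \<open>Independence is between the signal and the pair of noises, so the noise bound is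
    taken as a measurable subset of the plane.\<close>
  have N: "?N j \<in> sets (borel \<Otimes>\<^sub>M borel)" for j
  proof -
    have "{e \<in> space (borel \<Otimes>\<^sub>M borel). \<bar>fst e - snd e\<bar> < 2 * tau m G1 G2 j} \<in> sets (borel \<Otimes>\<^sub>M borel)"
      by measurable
    then show ?thesis by (simp add: space_pair_measure)
  qed
  have "(\<Sum>j\<in>?J. prob {\<omega> \<in> space M. \<bar>E1 \<omega> - E2 \<omega>\<bar> < 2 * tau m G1 G2 j} *
      prob {\<omega> \<in> space M. X \<omega> \<in> ?I j}) = (\<Sum>j\<in>?J. prob (S j))"
    unfolding S_def using indep_rv_prob[OF assms(11) _ N, of "?I _"] by (simp add: mult.commute)
  also have "\<dots> = prob (\<Union>j\<in>?J. S j)"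
  proof (rule finite_measure_finite_Union[symmetric])
    show "S ` ?J \<subseteq> sets M"
      unfolding S_def by auto
    show "disjoint_family_on S ?J"
      unfolding disjoint_family_on_def S_def
      using layers_disjoint[OF assms(2-4,1)] by blast
  qed simp
  also have "\<dots> \<le> prob {\<omega> \<in> space M. reconstructs m G1 G2 D (X \<omega>) (E1 \<omega>) (E2 \<omega>)}"
  proof (rule finite_measure_mono)
    show "(\<Union>j\<in>?J. S j) \<subseteq> {\<omega> \<in> space M. reconstructs m G1 G2 D (X \<omega>) (E1 \<omega>) (E2 \<omega>)}"
      unfolding S_def reconstructs_def
      using decoder_correct[OF assms(2-4,1,13)] by fastforce
  qed (rule reconstructs_measurable[OF assms(2-4,1,13,6-8)])
  finally show ?thesis
    unfolding success_prob_def .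
qed

end
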